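(* Let $X$ be a separable Banach space and let $T\in B(X)$. Suppose that (i) the set $X_0:=\{x\in X:\lim_{n\to\infty}\|T^nx\|=0\}$ is dense in $X$, and (ii) $T$ is not power bounded, i.e. $\sup_{n\in\mathbb N}\|T^n\|=\infty$. Then there exists a dense reiteratively distributionally irregular manifold of type $1^+$ for $T$, i.e. a dense vector subspace $Y$ of $X$ such that every non-zero vector $y\in Y$ is irregular for $T$ and has orbit distributionally near to $0$.
   Context: $B(X)$ is the space of bounded linear operators $X\to X$. For $A\subset\mathbb N$, $\overline{\mathrm{dens}}(A)=\limsup_{n\to\infty}\frac{\mathrm{card}(A\cap[1,n])}{n}$. A vector $x$ is irregular for $T$ if $\liminf_{n\to\infty}\|T^nx\|=0$ and $\limsup_{n\to\infty}\|T^nx\|=\infty$. The orbit of $x$ is distributionally near to $0$ if there is $A\subset\mathbb N$ with $\overline{\mathrm{dens}}(A)=1$ and $\lim_{n\to\infty,\,n\in A}T^nx=0$. A reiteratively distributionally irregular manifold of type $1^+$ for $T$ is a vector subspace $Y$ of $X$ such that every non-zero $y\in Y$ is irregular for $T$ and has orbit distributionally near to $0$. *)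

theory Defs
  imports "HOL-Analysis.Analysis"
begin

text \<open>
  Banach spaces over \<open>\<real>\<close> and over \<open>\<complex>\<close> are treated uniformly. Up to isometric isomorphism, the
  fields of sort \<open>{real_normed_field, euclidean_space}\<close> are exactly \<open>\<real>\<close> and \<open>\<complex>\<close> with the usual
  absolute value: they are finite-dimensional over \<open>\<real>\<close> and have a multiplicative norm. The type
  class \<open>banach\<close> supplies the complete norm and the underlying real structure; \<open>smul\<close> is the
  multiplication by scalars of the field, which extends \<open>scaleR\<close>.
\<close>

locale banach_over =
  vector_space smul
  for smul :: "'k::{real_normed_field, euclidean_space} \<Rightarrow> 'a::banach \<Rightarrow> 'a" +
  assumes scale_of_real: "smul (of_real r) x = r *\<^sub>R x"
    and norm_scale: "norm (smul c x) = norm c * norm x"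

lemma banach_over_real: "banach_over (scaleR :: real \<Rightarrow> 'a::banach \<Rightarrow> 'a)"
  by unfold_locales (auto simp: scaleR_add_right scaleR_add_left)

lemma banach_over_complex: "banach_over ((*) :: complex \<Rightarrow> complex \<Rightarrow> complex)"
  by unfold_locales (auto simp: algebra_simps norm_mult scaleR_conv_of_real)

definition bounded_operators ::
    "('k::{real_normed_field, euclidean_space} \<Rightarrow> 'a::banach \<Rightarrow> 'a) \<Rightarrow> ('a \<Rightarrow> 'a) set" where
  "bounded_operators smul = {T. Vector_Spaces.linear smul smul T \<and> bounded_linear T}"

definition upper_density :: "nat set \<Rightarrow> ereal" where
  "upper_density A = limsup (\<lambda>n. ereal (real (card (A \<inter> {1..n})) / real n))"

definition irregular :: "('a::banach \<Rightarrow> 'a) \<Rightarrow> 'a \<Rightarrow> bool" where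
  "irregular T x \<longleftrightarrow>
     liminf (\<lambda>n. ereal (norm ((T ^^ n) x))) = 0 \<and>
     limsup (\<lambda>n. ereal (norm ((T ^^ n) x))) = \<infinity>"

definition distributionally_near_zero :: "('a::banach \<Rightarrow> 'a) \<Rightarrow> 'a \<Rightarrow> bool" where
  "distributionally_near_zero T x \<longleftrightarrow>
     (\<exists>A. upper_density A = 1 \<and> filterlim (\<lambda>n. (T ^^ n) x) (nhds 0) (inf sequentially (principal A)))"

definition rdi_manifold_1plus ::
    "('k::{real_normed_field, euclidean_space} \<Rightarrow> 'a::banach \<Rightarrow> 'a) \<Rightarrow> ('a \<Rightarrow> 'a) \<Rightarrow> 'a set \<Rightarrow> bool" where
  "rdi_manifold_1plus smul T Y \<longleftrightarrow>
     module.subspace smul Y \<and>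
     (\<forall>y\<in>Y. y \<noteq> 0 \<longrightarrow> irregular T y \<and> distributionally_near_zero T y)"

end

theory Submission
  imports Defs
begin

text \<open>
  A gliding hump argument. Since \<open>T\<close> is not power bounded and the vectors with null orbit are dense,
  there are tiny vectors \<open>v\<^sub>n\<close> with null orbit whose orbits stay tiny up to any prescribed time and
  later exceed \<open>n\<close>, at time \<open>m\<^sub>n\<close>. Choose them inductively so that \<open>m\<^sub>n\<close> comes after the orbits of
  \<open>v\<^sub>0, \<dots>, v\<^sub>n\<^sub>-\<^sub>1\<close> have died out, and \<open>v\<^sub>n\<^sub>+\<^sub>1\<close> stays small until \<open>(n + 1) N\<^sub>n\<close>, where \<open>N\<^sub>n\<close> is a time at
  which \<open>v\<^sub>0, \<dots>, v\<^sub>n\<close> have died out. Split the indices into infinitely many infinite classes and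
  let \<open>e\<^sub>k\<close> be the sum of the \<open>v\<^sub>n\<close> over the \<open>k\<close>-th class, plus a vector with null orbit that makes
  the \<open>e\<^sub>k\<close> dense. All orbits of the \<open>e\<^sub>k\<close> tend to 0 along the union of the blocks \<open>[N\<^sub>n, (n + 1) N\<^sub>n]\<close>,
  which has upper density 1, while at the times \<open>m\<^sub>n\<close> with \<open>n\<close> in the \<open>k\<close>-th class only \<open>e\<^sub>k\<close> is
  large. Hence the span of the \<open>e\<^sub>k\<close> is the required manifold.
\<close>

section \<open>Null orbits with late peaks and their inductive choice\<close>

lemma bounded_linear_funpow:
  fixes T :: "'a::real_normed_vector \<Rightarrow> 'a"
  assumes "bounded_linear T"
  shows "bounded_linear (T ^^ n)"
proof (induction n)
  case 0
  then show ?case by (simp add: id_def bounded_linear_ident)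
next
  case (Suc n)
  then show ?case
    using bounded_linear_compose[OF assms Suc] by (simp add: o_def)
qed

text \<open>Being short with a large image under \<open>T ^^ m\<close> is an open condition, so once
  some vector meets it, density supplies one with null orbit. Shortness alone controls the orbit up
  to time \<open>L\<close>.\<close>

lemma exists_null_orbit_with_peak:
  fixes T :: "'a::real_normed_vector \<Rightarrow> 'a"
  assumes T: "bounded_linear T"
    and dense: "closure {x. (\<lambda>n. norm ((T ^^ n) x)) \<longlonglongrightarrow> 0} = UNIV"
    and unbounded: "\<And>B. \<exists>n. onorm (T ^^ n) > B"
    and "\<epsilon> > 0"
  obtains v m where "(\<lambda>n. norm ((T ^^ n) v)) \<longlonglongrightarrow> 0" "m > L"
    "\<And>j. j \<le> L \<Longrightarrow> norm ((T ^^ j) v) \<le> \<epsilon>" "norm ((T ^^ m) v) > R"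
proof -
  note bl = bounded_linear_funpow[OF T]
  define C where "C = 1 + (\<Sum>j\<le>L. onorm (T ^^ j))"
  have sum_ge: "onorm (T ^^ j) \<le> (\<Sum>j\<le>L. onorm (T ^^ j))" if "j \<le> L" for j
    by (rule member_le_sum) (use that in \<open>auto intro: onorm_pos_le bl\<close>)
  have C: "C > 0"
    unfolding C_def by (simp add: add_pos_nonneg sum_nonneg onorm_pos_le bl)
  define \<delta> where "\<delta> = \<epsilon> / C"
  have \<delta>: "\<delta> > 0" using C \<open>\<epsilon> > 0\<close> by (simp add: \<delta>_def)
  \<comment> \<open>Exceeding \<open>C\<close> rules out \<open>m \<le> L\<close>; exceeding
    \<open>2 * R / \<delta>\<close> lets some vector of norm \<open>\<delta> / 2\<close> reach norm
    above \<open>R\<close> at time \<open>m\<close>.\<close>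
  define B where "B = max C (2 * R / \<delta>)"
  obtain m where m: "onorm (T ^^ m) > B" using unbounded by blast
  have "m > L"
  proof (rule ccontr)
    assume "\<not> m > L"
    then show False using m sum_ge[of m] by (simp add: B_def C_def)
  qed
  obtain u where u: "norm ((T ^^ m) u) > B * norm u"
    using onorm_bound[of B "T ^^ m"] m C by (metis B_def less_max_iff_disj less_imp_le linorder_not_le)
  then have "u \<noteq> 0"
    using linear_0[OF bounded_linear.linear[OF bl]] by auto
  define w where "w = (\<delta> / 2 / norm u) *\<^sub>R u"
  have nw: "norm w = \<delta> / 2" using \<open>u \<noteq> 0\<close> \<delta> by (simp add: w_def)
  have "norm ((T ^^ m) w) = \<delta> / 2 / norm u * norm ((T ^^ m) u)"
    using \<delta> by (simp add: w_def linear_scale[OF bounded_linear.linear[OF bl]])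
  also have "\<dots> > \<delta> / 2 / norm u * (B * norm u)"
    by (rule mult_strict_left_mono) (use u \<delta> \<open>u \<noteq> 0\<close> in auto)
  also have "\<delta> / 2 / norm u * (B * norm u) = \<delta> / 2 * B" using \<open>u \<noteq> 0\<close> by simp
  finally have "norm ((T ^^ m) w) > \<delta> / 2 * B" .
  moreover have "\<delta> / 2 * (2 * R / \<delta>) \<le> \<delta> / 2 * B"
    by (rule mult_left_mono) (use \<delta> in \<open>auto simp: B_def\<close>)
  ultimately have Tw: "norm ((T ^^ m) w) > R" using \<delta> by simp
  let ?U = "{w. norm w < \<delta> \<and> norm ((T ^^ m) w) > R}"
  have "open ?U"
    by (intro open_Collect_conj open_Collect_less continuous_intros
        linear_continuous_on[OF bl])
  moreover have "w \<in> ?U" using nw Tw \<delta> by simp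
  ultimately obtain v where v: "v \<in> ?U" "(\<lambda>n. norm ((T ^^ n) v)) \<longlonglongrightarrow> 0"
    using dense
    by (metis (mono_tags, lifting) UNIV_I closure_iff_nhds_not_empty disjoint_iff
        mem_Collect_eq subset_refl)
  show thesis
  proof
    fix j assume "j \<le> L"
    have "norm ((T ^^ j) v) \<le> onorm (T ^^ j) * norm v" by (rule onorm[OF bl])
    also have "\<dots> \<le> C * \<delta>"
      by (rule mult_mono) (use v sum_ge[OF \<open>j \<le> L\<close>] C in \<open>auto simp: C_def\<close>)
    finally show "norm ((T ^^ j) v) \<le> \<epsilon>" using C by (simp add: \<delta>_def)
  qed (use v \<open>m > L\<close> in auto)
qed

lemma eventually_norm_le_finite:
  fixes T :: "'a::real_normed_vector \<Rightarrow> 'a"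
  assumes "finite I" "\<And>i. i \<in> I \<Longrightarrow> (\<lambda>n. norm ((T ^^ n) (u i))) \<longlonglongrightarrow> 0"
    "\<And>i. i \<in> I \<Longrightarrow> \<epsilon> i > 0"
  shows "\<forall>\<^sub>F j in sequentially. \<forall>i\<in>I. norm ((T ^^ j) (u i)) \<le> \<epsilon> i"
  using assms(1) unfolding eventually_ball_finite_distrib[OF assms(1)]
  by (auto intro!: eventually_mono[OF order_tendstoD(2)[OF assms(2) assms(3)]] less_imp_le)

text \<open>In the late bounds the factor \<open>(1/2) ^ i\<close> gives summability over the humps
  and \<open>(1/2) ^ n\<close> makes the sum small in block \<open>n\<close>. Stage \<open>n\<close>
  controls only \<open>x 0\<close> to \<open>x n\<close>, since the orbits of the \<open>x k\<close>
  need not die out uniformly in \<open>k\<close>.\<close>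

lemma gliding_hump:
  fixes T :: "'a::real_normed_vector \<Rightarrow> 'a"
  assumes T: "bounded_linear T"
    and dense: "closure {x. (\<lambda>n. norm ((T ^^ n) x)) \<longlonglongrightarrow> 0} = UNIV"
    and unbounded: "\<And>B. \<exists>n. onorm (T ^^ n) > B"
    and x: "\<And>k. (\<lambda>n. norm ((T ^^ n) (x k))) \<longlonglongrightarrow> 0"
  obtains v N m where
    "\<And>n. norm (v n) \<le> (1/4) ^ n"
    "\<And>n i. i < n \<Longrightarrow> N i < m n"
    "\<And>n. m n \<le> N n"
    "\<And>n. n < N n"
    "\<And>n i j. i < n \<Longrightarrow> j \<le> (i + 1) * N i \<Longrightarrow> norm ((T ^^ j) (v n)) \<le> (1/4) ^ n"
    "\<And>n. norm ((T ^^ m n) (v n)) > real n"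
    "\<And>n i j. i \<le> n \<Longrightarrow> j \<ge> N n \<Longrightarrow> norm ((T ^^ j) (v i)) \<le> (1/2) ^ n * (1/2) ^ i"
    "\<And>n i j. i \<le> n \<Longrightarrow> j \<ge> N n \<Longrightarrow> norm ((T ^^ j) (x i)) \<le> (1/2) ^ n"
proof -
  \<comment> \<open>Stage \<open>n\<close> sees the whole history \<open>f\<close>: the bound on the
    earlier orbits tightens with \<open>n\<close>, so it is imposed anew at every stage.\<close>
  define P :: "(nat \<Rightarrow> 'a \<times> nat \<times> nat) \<Rightarrow> nat \<Rightarrow> 'a \<times> nat \<times> nat \<Rightarrow> bool" where
    "P = (\<lambda>f n (v, m, N). (\<lambda>k. norm ((T ^^ k) v)) \<longlonglongrightarrow> 0 \<and> norm v \<le> (1/4) ^ n \<and>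
        (\<forall>i<n. snd (snd (f i)) < m) \<and> m \<le> N \<and> n < N \<and>
        (\<forall>i<n. \<forall>j\<le>(i + 1) * snd (snd (f i)). norm ((T ^^ j) v) \<le> (1/4) ^ n) \<and>
        norm ((T ^^ m) v) > real n \<and>
        (\<forall>j\<ge>N. norm ((T ^^ j) v) \<le> (1/2) ^ n * (1/2) ^ n \<and>
          (\<forall>i<n. norm ((T ^^ j) (fst (f i))) \<le> (1/2) ^ n * (1/2) ^ i) \<and>
          (\<forall>i\<le>n. norm ((T ^^ j) (x i)) \<le> (1/2) ^ n)))"
  have "\<exists>f. \<forall>n. P f n (f n)"
  proof (rule dependent_wellorder_choice)
    show "P f n r = P g n r" if "\<And>i. i < n \<Longrightarrow> f i = g i" for r f g n
      using that by (auto simp: P_def)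
    fix n f assume prev: "\<And>i. i < n \<Longrightarrow> P f i (f i)"
    have null: "(\<lambda>k. norm ((T ^^ k) (fst (f i)))) \<longlonglongrightarrow> 0" if "i < n" for i
      using prev[OF that] by (auto simp: P_def split: prod.splits)
    \<comment> \<open>The sum serves as a common upper bound for the ends of the earlier blocks;
      \<open>m > L\<close> then also puts \<open>m\<close> after every earlier
      \<open>N\<close>.\<close>
    define L where "L = (\<Sum>i<n. (i + 1) * snd (snd (f i)))"
    have L: "(i + 1) * snd (snd (f i)) \<le> L" if "i < n" for i
      unfolding L_def using that by (intro member_le_sum) auto
    obtain v m where v: "(\<lambda>n. norm ((T ^^ n) v)) \<longlonglongrightarrow> 0" "m > L"
      "\<And>j. j \<le> L \<Longrightarrow> norm ((T ^^ j) v) \<le> (1/4) ^ n" "norm ((T ^^ m) v) > real n"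
      using exists_null_orbit_with_peak[OF T dense unbounded, of "(1/4) ^ n" L "real n"] by auto
    have "\<forall>\<^sub>F j in sequentially. (\<forall>i\<in>{n}. norm ((T ^^ j) v) \<le> (1/2) ^ n * (1/2) ^ n) \<and>
        (\<forall>i\<in>{..<n}. norm ((T ^^ j) (fst (f i))) \<le> (1/2) ^ n * (1/2) ^ i) \<and>
        (\<forall>i\<in>{..n}. norm ((T ^^ j) (x i)) \<le> (1/2) ^ n)"
      by (intro eventually_conj eventually_norm_le_finite) (use null v x in auto)
    then obtain N where N: "\<And>j. j \<ge> N \<Longrightarrow> (\<forall>i\<in>{n}. norm ((T ^^ j) v) \<le> (1/2) ^ n * (1/2) ^ n) \<and>
        (\<forall>i\<in>{..<n}. norm ((T ^^ j) (fst (f i))) \<le> (1/2) ^ n * (1/2) ^ i) \<and>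
        (\<forall>i\<in>{..n}. norm ((T ^^ j) (x i)) \<le> (1/2) ^ n)"
      unfolding eventually_sequentially by blast
    \<comment> \<open>The entries \<open>m\<close> and \<open>n + 1\<close> enforce
      \<open>m \<le> N\<close> and \<open>n < N\<close>. The bound on \<open>norm v\<close> is the
      case \<open>j = 0\<close> of smallness up to \<open>L\<close>.\<close>
    have "P f n (v, m, Max {N, m, n + 1})"
      unfolding P_def prod.case
    proof (intro conjI allI impI)
      fix i assume "i < n"
      then show "snd (snd (f i)) < m" using L[of i] v(2) by simp
      fix j assume "j \<le> (i + 1) * snd (snd (f i))"
      then show "norm ((T ^^ j) v) \<le> (1/4) ^ n" using L[OF \<open>i < n\<close>] v(3) by simp
    qed (use v v(3)[of 0] N in auto)
    then show "\<exists>r. P f n r" by blast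
  qed
  then obtain f where f: "\<And>n. P f n (f n)" by blast
  show thesis
  proof (rule that[of "\<lambda>n. fst (f n)" "\<lambda>n. snd (snd (f n))" "\<lambda>n. fst (snd (f n))"])
    fix n i j assume "i \<le> n" "j \<ge> snd (snd (f n))"
    then show "norm ((T ^^ j) (fst (f i))) \<le> (1/2) ^ n * (1/2) ^ i"
      using f[of n] by (cases "i = n") (auto simp: P_def split: prod.splits)
  qed (use f in \<open>auto simp: P_def split_beta\<close>)
qed

section \<open>Criteria for upper density 1 and for irregularity\<close>

text \<open>Block \<open>n\<close> fills at least \<open>n * N n\<close> of the first
  \<open>(n + 1) * N n\<close> positive integers, and the proportion \<open>n / (n + 1)\<close>
  tends to 1.\<close>

lemma upper_density_blocks:
  assumes "\<And>n. 0 < N n" "strict_mono N"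
  shows "upper_density (\<Union>n. {N n..(n + 1) * N n}) = 1"
proof (rule antisym)
  let ?A = "\<Union>n. {N n..(n + 1) * N n}"
  let ?d = "\<lambda>n. ereal (real (card (?A \<inter> {1..n})) / real n)"
  have "card (?A \<inter> {1..n}) \<le> n" for n
    using card_mono[of "{1..n}" "?A \<inter> {1..n}"] by simp
  then have "?d n \<le> 1" for n
    by (auto simp: divide_simps one_ereal_def)
  then show "upper_density ?A \<le> 1"
    unfolding upper_density_def by (intro Limsup_bounded) auto
  define M where "M = (\<lambda>n. (n + 1) * N n)"
  have M: "strict_mono M"
    unfolding strict_mono_Suc_iff M_def
    by (intro allI mult_strict_mono) (use assms in \<open>auto simp: strict_mono_Suc_iff\<close>)
  have le: "ereal (real n / real (Suc n)) \<le> ?d (M n)" for n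
  proof -
    have "n * N n \<le> card {N n..M n}" by (simp add: M_def)
    also have "\<dots> \<le> card (?A \<inter> {1..M n})"
      using assms(1)[of n] by (intro card_mono) (auto simp: M_def)
    finally have "real (n * N n) / real (M n) \<le> real (card (?A \<inter> {1..M n})) / real (M n)"
      by (intro divide_right_mono of_nat_mono) auto
    moreover have "real (n * N n) / real (M n) = real n / real (Suc n)"
      unfolding M_def of_nat_mult Suc_eq_plus1
      by (rule nonzero_mult_divide_mult_cancel_right) (use assms(1)[of n] in simp)
    ultimately show ?thesis by simp
  qed
  have "(\<lambda>n. ereal (real n / real (Suc n))) \<longlonglongrightarrow> ereal 1"
    using LIMSEQ_n_over_Suc_n[where 'a=real] by (simp only: lim_ereal)
  then have "1 = limsup (\<lambda>n. ereal (real n / real (Suc n)))"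
    unfolding one_ereal_def by (intro lim_imp_Limsup[symmetric]) auto
  also have "\<dots> \<le> limsup (?d \<circ> M)"
    by (intro Limsup_mono always_eventually) (use le in simp)
  also have "\<dots> \<le> limsup ?d" by (rule limsup_subseq_mono[OF M])
  finally show "1 \<le> upper_density ?A" by (simp add: upper_density_def)
qed

text \<open>Passing to a subsequence can neither lower the liminf nor raise the limsup, so one
  sequence of times settles each.\<close>

lemma irregularI:
  assumes N: "strict_mono N" "(\<lambda>n. (T ^^ N n) y) \<longlonglongrightarrow> 0"
    and m: "strict_mono m" "filterlim (\<lambda>n. norm ((T ^^ m n) y)) at_top sequentially"
  shows "irregular T y"
  unfolding irregular_def
proof
  let ?f = "\<lambda>n. ereal (norm ((T ^^ n) y))"
  have "liminf ?f \<le> liminf (?f \<circ> N)" by (rule liminf_subseq_mono[OF N(1)])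
  also have "(?f \<circ> N) \<longlonglongrightarrow> ereal 0"
    unfolding o_def lim_ereal using tendsto_norm[OF N(2)] by simp
  then have "liminf (?f \<circ> N) = 0" by (simp add: lim_imp_Liminf zero_ereal_def)
  finally show "liminf ?f = 0"
    by (intro antisym Liminf_bounded) (auto simp: zero_ereal_def)
  have "(?f \<circ> m) \<longlonglongrightarrow> \<infinity>"
    using m(2) unfolding o_def tendsto_PInfty filterlim_at_top_dense by auto
  then have "limsup (?f \<circ> m) = \<infinity>" by (simp add: lim_imp_Limsup)
  then show "limsup ?f = \<infinity>" using limsup_subseq_mono[OF m(1), of ?f] by simp
qed

lemma linear_funpow_sum_scale:
  assumes "Vector_Spaces.linear smul smul T"
  shows "(T ^^ j) (\<Sum>k\<in>S. smul (c k) (e k)) = (\<Sum>k\<in>S. smul (c k) ((T ^^ j) (e k)))"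
proof -
  interpret L: Vector_Spaces.linear smul smul T by fact
  show ?thesis by (induction j) (simp_all add: L.sum L.scale)
qed


section \<open>Summing the humps over the classes\<close>

text \<open>Each constant 3 is 1 from \<open>x k\<close> plus 2 from a geometric series of humps.
  Bounding \<open>e k\<close> only for \<open>k\<close> up to or below \<open>n\<close> suits finite
  linear combinations, whose indices are eventually all below \<open>n\<close>.\<close>

lemma exists_irregular_sequence:
  fixes T :: "'a::banach \<Rightarrow> 'a"
  assumes T: "bounded_linear T"
    and dense: "closure {x. (\<lambda>n. norm ((T ^^ n) x)) \<longlonglongrightarrow> 0} = UNIV"
    and unbounded: "\<And>B. \<exists>n. onorm (T ^^ n) > B"
  obtains e m N where
    "\<And>k. norm (e k - d k) \<le> 3 * (1/2) ^ k"
    "strict_mono N" "\<And>n. 0 < N n"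
    "\<And>n k j. k \<le> n \<Longrightarrow> N n \<le> j \<Longrightarrow> j \<le> (n + 1) * N n \<Longrightarrow> norm ((T ^^ j) (e k)) \<le> 3 * (1/2) ^ n"
    "strict_mono m"
    "\<And>n k. k < n \<Longrightarrow> k \<noteq> fst (prod_decode n) \<Longrightarrow> norm ((T ^^ m n) (e k)) \<le> 3"
    "\<And>n k. k < n \<Longrightarrow> k = fst (prod_decode n) \<Longrightarrow> norm ((T ^^ m n) (e k)) \<ge> real n - 3"
proof -
  note bl = bounded_linear_funpow[OF T]
  have "\<exists>x. (\<lambda>n. norm ((T ^^ n) x)) \<longlonglongrightarrow> 0 \<and> norm (x - d k) < (1/2) ^ k" for k
  proof -
    have "d k \<in> closure {x. (\<lambda>n. norm ((T ^^ n) x)) \<longlonglongrightarrow> 0}" using dense by simp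
    then show ?thesis
      unfolding closure_approachable by (force simp: dist_norm)
  qed
  then obtain x where x: "\<And>k. (\<lambda>n. norm ((T ^^ n) (x k))) \<longlonglongrightarrow> 0"
    "\<And>k. norm (x k - d k) < (1/2) ^ k" by metis
  obtain v N m where v: "\<And>n. norm (v n) \<le> (1/4) ^ n"
    and N_less_m: "\<And>n i. i < n \<Longrightarrow> N i < m n"
    and m_le_N: "\<And>n. m n \<le> N n"
    and N_gt: "\<And>n. n < N n"
    and before: "\<And>n i j. i < n \<Longrightarrow> j \<le> (i + 1) * N i \<Longrightarrow> norm ((T ^^ j) (v n)) \<le> (1/4) ^ n"
    and peak: "\<And>n. norm ((T ^^ m n) (v n)) > real n"
    and after: "\<And>n i j. i \<le> n \<Longrightarrow> j \<ge> N n \<Longrightarrow> norm ((T ^^ j) (v i)) \<le> (1/2) ^ n * (1/2) ^ i"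
    and x_after: "\<And>n i j. i \<le> n \<Longrightarrow> j \<ge> N n \<Longrightarrow> norm ((T ^^ j) (x i)) \<le> (1/2) ^ n"
    by (rule gliding_hump[OF T dense unbounded x(1)], rule that)
  \<comment> \<open>The fibres of \<open>\<kappa>\<close> are the infinite classes. By
    \<open>\<kappa> i \<le> i\<close>, class \<open>k\<close> has no hump before index
    \<open>k\<close>, so its sum has norm at most \<open>2 * (1/2) ^ k\<close>.\<close>
  define \<kappa> where "\<kappa> = (\<lambda>i. fst (prod_decode i))"
  have \<kappa>_le: "\<kappa> i \<le> i" for i
    using le_prod_encode_1[of "fst (prod_decode i)" "snd (prod_decode i)"] by (simp add: \<kappa>_def)
  define w where "w = (\<lambda>k i. if \<kappa> i = k then v i else 0)"
  have geom: "summable (\<lambda>i. c * (1/2) ^ i :: real)" "(\<Sum>i. c * (1/2) ^ i :: real) = 2 * c" for c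
    using suminf_mult[of "\<lambda>i. (1/2) ^ i :: real" c] suminf_geometric[of "1/2 :: real"]
    by (auto intro!: summable_mult summable_geometric)
  have quarter: "(1/4 :: real) ^ i \<le> (1/2) ^ n * (1/2) ^ i" if "n \<le> i" for n i
  proof -
    have "(1/4 :: real) ^ i = (1/2) ^ i * (1/2) ^ i"
      by (simp flip: power_mult_distrib)
    also have "\<dots> \<le> (1/2) ^ n * (1/2) ^ i"
      by (intro mult_right_mono power_decreasing that) auto
    finally show ?thesis .
  qed
  have norm_w: "norm (w k i) \<le> (1/2) ^ k * (1/2) ^ i" for k i
    using v[of i] quarter[of k i] \<kappa>_le[of i] by (auto simp: w_def)
  have summable_w: "summable (w k)" for k
    by (rule summable_comparison_test'[OF geom(1) norm_w])
  define e where "e = (\<lambda>k. x k + suminf (w k))"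
  have T_e: "(T ^^ j) (e k) = (T ^^ j) (x k) + (\<Sum>i. (T ^^ j) (w k i))" for j k
    unfolding e_def using bounded_linear.suminf[OF bl summable_w]
    by (simp add: linear_add[OF bounded_linear.linear[OF bl]])
  have summable_Tw: "summable (\<lambda>i. (T ^^ j) (w k i))" for j k
    by (rule bounded_linear.summable[OF bl summable_w])
  have norm_Tw: "norm ((T ^^ j) (w k i)) \<le> norm ((T ^^ j) (v i))" for j k i
    using linear_0[OF bounded_linear.linear[OF bl]] by (auto simp: w_def)
  have sum_bound: "norm (\<Sum>i. f i) \<le> 2 * c" if "\<And>i. norm (f i) \<le> c * (1/2) ^ i"
    for f :: "nat \<Rightarrow> 'a" and c
    using norm_suminf_le[OF that geom(1)] geom(2) by simp
  have N_mono: "strict_mono N" unfolding strict_mono_Suc_iff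
    using N_less_m m_le_N by (meson lessI order_less_le_trans)
  have m_mono: "strict_mono m" unfolding strict_mono_Suc_iff
    using N_less_m m_le_N by (meson lessI order_le_less_trans)
  \<comment> \<open>For \<open>i < n\<close>, hump \<open>i\<close> has died out by time
    \<open>N (n - 1) < m n\<close>; for \<open>i > n\<close>, it is still small because
    \<open>m n \<le> N n\<close>.\<close>
  have off_peak: "norm ((T ^^ m n) (v i)) \<le> 1 * (1/2) ^ i" if "i \<noteq> n" for n i
  proof (cases "i < n")
    case True
    then obtain n' where n': "n = Suc n'" by (cases n) auto
    have "norm ((T ^^ m n) (v i)) \<le> (1/2) ^ n' * (1/2) ^ i"
      using True N_less_m[of n' n] n' by (intro after) auto
    also have "\<dots> \<le> 1 * (1/2) ^ i" by (intro mult_right_mono power_le_one) auto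
    finally show ?thesis .
  next
    case False
    then have "norm ((T ^^ m n) (v i)) \<le> (1/4) ^ i"
      using that m_le_N[of n] by (intro before[of n]) auto
    then show ?thesis using quarter[of 0 i] by simp
  qed
  \<comment> \<open>The preceding control time \<open>N (n - 1)\<close> covers \<open>x k\<close>
    only for \<open>k \<le> n - 1\<close>, whence the strict \<open>k < n\<close>.\<close>
  have x_peak: "norm ((T ^^ m n) (x k)) \<le> 1" if "k < n" for n k
  proof -
    obtain n' where n': "n = Suc n'" using \<open>k < n\<close> by (cases n) auto
    have "norm ((T ^^ m n) (x k)) \<le> (1/2) ^ n'"
      using \<open>k < n\<close> N_less_m[of n' n] n' by (intro x_after) auto
    then show ?thesis using power_le_one[of "1/2::real" n'] by simp
  qed
  show thesis
  proof (rule that[of e N m])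
    show "norm (e k - d k) \<le> 3 * (1/2) ^ k" for k
      using norm_triangle_ineq[of "x k - d k" "suminf (w k)"] x(2)[of k] sum_bound[OF norm_w, of k]
      by (simp add: e_def algebra_simps)
  next
    fix n k j assume n: "k \<le> n" "N n \<le> j" "j \<le> (n + 1) * N n"
    \<comment> \<open>In block \<open>n\<close> the humps up to \<open>n\<close> are over and the
      later ones have not begun; both cases fit one geometric bound.\<close>
    have "norm ((T ^^ j) (v i)) \<le> (1/2) ^ n * (1/2) ^ i" for i
    proof (cases "i \<le> n")
      case False
      then show ?thesis using before[of n i j] quarter[of n i] n by simp
    qed (use after n in auto)
    then have "norm (\<Sum>i. (T ^^ j) (w k i)) \<le> 2 * (1/2) ^ n"
      by (intro sum_bound order_trans[OF norm_Tw])
    then show "norm ((T ^^ j) (e k)) \<le> 3 * (1/2) ^ n"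
      unfolding T_e using x_after[OF n(1,2)] norm_triangle_ineq[of "(T ^^ j) (x k)" "\<Sum>i. (T ^^ j) (w k i)"]
      by linarith
  next
    fix n k assume k: "k < n" "k \<noteq> fst (prod_decode n)"
    \<comment> \<open>The index \<open>i = n\<close> excluded by \<open>off_peak\<close> is harmless
      here: hump \<open>n\<close> lies in another class, so \<open>w k n = 0\<close>.\<close>
    have "norm ((T ^^ m n) (w k i)) \<le> 1 * (1/2) ^ i" for i
      using order_trans[OF norm_Tw off_peak] k(2) linear_0[OF bounded_linear.linear[OF bl]]
      by (cases "i = n") (auto simp: w_def \<kappa>_def)
    then have "norm (\<Sum>i. (T ^^ m n) (w k i)) \<le> 2 * 1" by (rule sum_bound)
    then show "norm ((T ^^ m n) (e k)) \<le> 3"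
      unfolding T_e using x_peak[OF k(1)] norm_triangle_ineq[of "(T ^^ m n) (x k)" "\<Sum>i. (T ^^ m n) (w k i)"]
      by linarith
  next
    fix n k assume k: "k < n" "k = fst (prod_decode n)"
    \<comment> \<open>The series is split into its peak term \<open>?h\<close> and the remainder
      \<open>?g\<close>, which obeys the off-peak bound.\<close>
    let ?g = "\<lambda>i. if i = n then 0 else (T ^^ m n) (w k i)"
    let ?h = "\<lambda>i. if i = n then (T ^^ m n) (v n) else 0"
    have g: "norm (?g i) \<le> 1 * (1/2) ^ i" for i
      using order_trans[OF norm_Tw off_peak] by auto
    have "(\<lambda>i. (T ^^ m n) (w k i)) = (\<lambda>i. ?h i + ?g i)"
      using k(2) by (auto simp: w_def \<kappa>_def)
    then have "(\<Sum>i. (T ^^ m n) (w k i)) = suminf ?h + suminf ?g"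
      using suminf_add[of ?h ?g] sums_single[of n "\<lambda>i. (T ^^ m n) (v n)"]
        summable_comparison_test'[OF geom(1) g]
      by (simp add: sums_iff)
    also have "suminf ?h = (T ^^ m n) (v n)"
      using sums_single[of n "\<lambda>i. (T ^^ m n) (v n)"] by (simp add: sums_iff)
    finally have "(T ^^ m n) (e k) = (T ^^ m n) (v n) + ((T ^^ m n) (x k) + suminf ?g)"
      unfolding T_e by simp
    moreover have "norm ((T ^^ m n) (x k) + suminf ?g) \<le> 3"
      using norm_triangle_ineq[of "(T ^^ m n) (x k)" "suminf ?g"] x_peak[OF k(1)] sum_bound[OF g]
      by simp
    ultimately show "norm ((T ^^ m n) (e k)) \<ge> real n - 3"
      using peak[of n] norm_diff_ineq[of "(T ^^ m n) (v n)" "(T ^^ m n) (x k) + suminf ?g"]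
      by simp
  qed (use N_mono m_mono N_gt in \<open>auto intro: order_le_less_trans[OF le0]\<close>)
qed

section \<open>The span of the sequence as the required manifold\<close>

text \<open>As \<open>e\<close> may repeat values, one index is chosen for each vector of the
  combination.\<close>

lemma (in vector_space) span_range_obtain_sum:
  assumes "y \<in> span (range e)"
  obtains S c where "finite S" "y = (\<Sum>k\<in>S. scale (c k) (e k))"
proof -
  obtain t r where t: "finite t" "t \<subseteq> range e" and y: "y = (\<Sum>a\<in>t. scale (r a) a)"
    using assms unfolding span_explicit by blast
  obtain S where S: "inj_on e S" "t = e ` S"
    using t(2) by (meson subset_image_inj)
  show thesis
  proof
    show "finite S" using finite_imageD S t(1) by blast
    show "y = (\<Sum>k\<in>S. scale ((r \<circ> e) k) (e k))"
      unfolding y S(2) using sum.reindex[OF S(1), of "\<lambda>a. scale (r a) a"] by simp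
  qed
qed

theorem theorem3p1:
  fixes smul :: "'k::{real_normed_field, euclidean_space} \<Rightarrow> 'a::banach \<Rightarrow> 'a"
    and T :: "'a \<Rightarrow> 'a"
  assumes "banach_over smul"
    and "separable_space (euclidean :: 'a topology)"
    and "T \<in> bounded_operators smul"
    and "closure {x. (\<lambda>n. norm ((T ^^ n) x)) \<longlonglongrightarrow> 0} = UNIV"
    and "(SUP n. ereal (onorm (T ^^ n))) = \<infinity>"
  shows "\<exists>Y. rdi_manifold_1plus smul T Y \<and> closure Y = UNIV"
proof -
  interpret banach_over smul by fact
  have lin: "Vector_Spaces.linear smul smul T" and T: "bounded_linear T"
    using assms(3) by (auto simp: bounded_operators_def)
  have unbounded: "\<exists>n. onorm (T ^^ n) > B" for B
    using less_SUP_iff[of "ereal B" "\<lambda>n. ereal (onorm (T ^^ n))" UNIV] assms(5) by auto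
  obtain D :: "'a set" where D: "countable D" "closure D = UNIV"
    using assms(2) by (auto simp: separable_space_def euclidean_closure_of)
  then have "D \<noteq> {}" by auto
  \<comment> \<open>Every point of \<open>D\<close> is repeated infinitely often, so perturbations tending to 0 stay dense.\<close>
  define d where "d = (\<lambda>k. from_nat_into D (fst (prod_decode k)))"
  obtain e m N where
    e: "\<And>k. norm (e k - d k) \<le> 3 * (1/2) ^ k" and
    N: "strict_mono N" "\<And>n. 0 < N n" and
    small: "\<And>n k j. k \<le> n \<Longrightarrow> N n \<le> j \<Longrightarrow> j \<le> (n + 1) * N n \<Longrightarrow>
      norm ((T ^^ j) (e k)) \<le> 3 * (1/2) ^ n" and
    m: "strict_mono m" and
    off_peak: "\<And>n k. k < n \<Longrightarrow> k \<noteq> fst (prod_decode n) \<Longrightarrow> norm ((T ^^ m n) (e k)) \<le> 3" and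
    peak: "\<And>n k. k < n \<Longrightarrow> k = fst (prod_decode n) \<Longrightarrow> norm ((T ^^ m n) (e k)) \<ge> real n - 3"
    by (rule exists_irregular_sequence[OF T assms(4) unbounded, of d], rule that)
  define Y where "Y = span (range e)"
  define A where "A = (\<Union>n. {N n..(n + 1) * N n})"
  have half: "(\<lambda>n. 3 * (1/2::real) ^ n) \<longlonglongrightarrow> 0"
    by (intro tendsto_mult_right_zero LIMSEQ_realpow_zero) auto
  have enc: "n \<le> prod_encode (k, n)" for k n by (rule le_prod_encode_2)
  have "closure Y = UNIV"
  proof (rule equalityI[OF subset_UNIV], rule subsetI)
    fix z :: 'a
    show "z \<in> closure Y"
      unfolding closure_approachable
    proof (intro allI impI)
      fix \<epsilon> :: real assume "\<epsilon> > 0"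
      obtain u where u: "u \<in> D" "dist u z < \<epsilon> / 2"
        using D(2) \<open>\<epsilon> > 0\<close> closure_approachable[of z D] by (metis UNIV_I half_gt_zero)
      obtain a where a: "u = from_nat_into D a"
        using from_nat_into_surj[OF D(1) u(1)] by metis
      obtain n0 where n0: "\<And>n. n \<ge> n0 \<Longrightarrow> 3 * (1/2::real) ^ n < \<epsilon> / 2"
        using order_tendstoD(2)[OF half, of "\<epsilon> / 2"] \<open>\<epsilon> > 0\<close>
        by (auto simp: eventually_sequentially)
      \<comment> \<open>The first coordinate gives \<open>d k = u\<close>; the second forces
        \<open>k \<ge> n0\<close>, so \<open>e k\<close> is close to \<open>d k\<close>.\<close>
      define k where "k = prod_encode (a, n0)"
      have "dist (e k) u < \<epsilon> / 2"
        using e[of k] n0[of k] enc[of n0 a] by (simp add: k_def d_def a dist_norm)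
      then have "dist (e k) z < \<epsilon>" using u(2) dist_triangle[of "e k" z u] by simp
      then show "\<exists>y\<in>Y. dist y z < \<epsilon>" by (auto simp: Y_def intro!: bexI[of _ "e k"] span_base)
    qed
  qed
  moreover have "rdi_manifold_1plus smul T Y"
    unfolding rdi_manifold_1plus_def
  proof (intro conjI ballI impI)
    show "subspace Y" by (simp add: Y_def subspace_span)
    fix y assume "y \<in> Y" "y \<noteq> 0"
    then obtain S c where S: "finite S" and y: "y = (\<Sum>k\<in>S. smul (c k) (e k))"
      using span_range_obtain_sum unfolding Y_def by metis
    \<comment> \<open>A nonzero coefficient singles out a class \<open>k0\<close> whose peaks will
      make the orbit of \<open>y\<close> unbounded.\<close>
    have "y = 0" if "\<And>k. k \<in> S \<Longrightarrow> c k = 0"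
      unfolding y by (rule sum.neutral) (simp add: that)
    then obtain k0 where k0: "k0 \<in> S" "c k0 \<noteq> 0" using \<open>y \<noteq> 0\<close> by blast
    have Ty: "(T ^^ j) y = (\<Sum>k\<in>S. smul (c k) ((T ^^ j) (e k)))" for j
      unfolding y by (rule linear_funpow_sum_scale[OF lin])
    obtain K where K: "\<And>k. k \<in> S \<Longrightarrow> k < K"
      using S unfolding finite_nat_set_iff_bounded by blast
    define C where "C = (\<Sum>k\<in>S. norm (c k))"
    have Ty_small: "norm ((T ^^ j) y) \<le> C * (3 * (1/2) ^ n)"
      if "K \<le> n" "N n \<le> j" "j \<le> (n + 1) * N n" for n j
      unfolding Ty C_def sum_distrib_right
    proof (rule sum_norm_le)
      fix k assume "k \<in> S"
      then have "k \<le> n" using K[of k] that(1) by simp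
      from small[OF this that(2,3)]
      show "norm (smul (c k) ((T ^^ j) (e k))) \<le> norm (c k) * (3 * (1/2) ^ n)"
        unfolding norm_scale by (rule mult_left_mono) simp
    qed
    have lim: "(\<lambda>n. C * (3 * (1/2) ^ n)) \<longlonglongrightarrow> 0"
      by (rule tendsto_mult_right_zero[OF half])
    show "distributionally_near_zero T y"
      unfolding distributionally_near_zero_def
    proof (intro exI conjI)
      show "upper_density A = 1" unfolding A_def by (rule upper_density_blocks[OF N(2,1)])
      show "((\<lambda>n. (T ^^ n) y) \<longlongrightarrow> 0) (inf sequentially (principal A))"
      proof (rule tendstoI)
        fix \<epsilon> :: real assume "\<epsilon> > 0"
        then obtain n0 where n0: "\<And>n. n \<ge> n0 \<Longrightarrow> C * (3 * (1/2::real) ^ n) < \<epsilon>"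
          using order_tendstoD(2)[OF lim, of \<epsilon>] by (auto simp: eventually_sequentially)
        \<comment> \<open>Right ends of blocks increase, so a time in \<open>A\<close> past the end
          of block \<open>n1\<close> lies in a later block, where \<open>Ty_small\<close>
          applies.\<close>
        define n1 where "n1 = max n0 K"
        have "norm ((T ^^ j) y) < \<epsilon>" if "j > (n1 + 1) * N n1" "j \<in> A" for j
        proof -
          obtain n where n: "N n \<le> j" "j \<le> (n + 1) * N n" using \<open>j \<in> A\<close> by (auto simp: A_def)
          have "n1 < n"
          proof (rule ccontr)
            assume "\<not> n1 < n"
            then have "(n + 1) * N n \<le> (n1 + 1) * N n1"
              using strict_mono_leD[OF N(1)] by (intro mult_mono) auto
            then show False using that n by simp
          qed
          then show ?thesis using Ty_small[OF _ n] n0[of n] by (simp add: n1_def)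
        qed
        then show "\<forall>\<^sub>F j in inf sequentially (principal A). dist ((T ^^ j) y) 0 < \<epsilon>"
          unfolding eventually_inf_principal
          by (auto intro: eventually_mono[OF eventually_gt_at_top])
      qed
    qed
    show "irregular T y"
    proof (rule irregularI[OF N(1)])
      show "(\<lambda>n. (T ^^ N n) y) \<longlonglongrightarrow> 0"
        by (rule Lim_null_comparison[OF _ lim])
          (auto intro!: eventually_mono[OF eventually_ge_at_top[of K]] Ty_small)
      \<comment> \<open>These indices run increasingly through class \<open>k0\<close>. Since
        \<open>?p i \<ge> i\<close>, the peak of \<open>e k0\<close> at time \<open>m (?p i)\<close>
        is at least \<open>i - 3\<close>.\<close>
      let ?p = "\<lambda>i. prod_encode (k0, i)"
      show "strict_mono (\<lambda>i. m (?p i))"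
        using m by (auto simp: strict_mono_Suc_iff prod_encode_def intro!: strict_monoD[OF m])
      show "filterlim (\<lambda>i. norm ((T ^^ m (?p i)) y)) at_top sequentially"
      proof (rule filterlim_at_top_mono)
        show "filterlim (\<lambda>i. norm (c k0) * (real i - 3) - C * 3) at_top sequentially"
          using k0(2) unfolding diff_conv_add_uminus add.commute[of _ "- _"]
          by (intro filterlim_tendsto_add_at_top[OF tendsto_const] filterlim_real_sequentially
              filterlim_tendsto_pos_mult_at_top[OF tendsto_const]) auto
        have "norm (c k0) * (real i - 3) - C * 3 \<le> norm ((T ^^ m (?p i)) y)" if "i \<ge> K" for i
        proof -
          let ?j = "m (?p i)"
          have less: "k < ?p i" if "k \<in> S" for k
            using K[OF that] \<open>i \<ge> K\<close> enc[of i k0] by simp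
          \<comment> \<open>At a peak time of class \<open>k0\<close> every other \<open>e k\<close>
            in the combination has norm at most 3, so these terms cannot cancel the growing
            one.\<close>
          have "norm (\<Sum>k\<in>S - {k0}. smul (c k) ((T ^^ ?j) (e k))) \<le> (\<Sum>k\<in>S - {k0}. norm (c k) * 3)"
            by (rule sum_norm_le)
              (use less off_peak[of _ "?p i"] in \<open>auto simp: norm_scale intro!: mult_left_mono\<close>)
          also have "\<dots> \<le> C * 3"
            unfolding C_def sum_distrib_right using S by (intro sum_mono2) auto
          finally have rest: "norm (\<Sum>k\<in>S - {k0}. smul (c k) ((T ^^ ?j) (e k))) \<le> C * 3" .
          have "norm (c k0) * (real i - 3) \<le> norm (c k0) * norm ((T ^^ ?j) (e k0))"
            using peak[OF less[OF k0(1)]] enc[of i k0] by (intro mult_left_mono) auto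
          also have "\<dots> = norm (smul (c k0) ((T ^^ ?j) (e k0)))" by (simp add: norm_scale)
          finally show ?thesis
            using rest norm_diff_ineq[of "smul (c k0) ((T ^^ ?j) (e k0))"
                "\<Sum>k\<in>S - {k0}. smul (c k) ((T ^^ ?j) (e k))"]
            unfolding Ty sum.remove[OF S k0(1)] by simp
        qed
        then show "\<forall>\<^sub>F i in sequentially. norm (c k0) * (real i - 3) - C * 3 \<le> norm ((T ^^ m (?p i)) y)"
          by (auto intro: eventually_mono[OF eventually_ge_at_top])
      qed
    qed
  qed
  ultimately show ?thesis by blast
qed

end
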